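(* Let $\mathbf v\in\mathbb R^d$, $\hat\rho>0$, and let $\mathbf z^*$ be the optimal solution of $$\min_{\mathbf z\in\mathbb R^d}\ \frac12\|\mathbf z-\mathbf v\|_2^2+\frac{\hat\rho}2\|\mathbf z\|_1^2.$$ If $\mathbf v=0$, then $\mathbf z^*=0$. Otherwise, suppose $\mathbf v\ne0$ and let $i_1,\dots,i_d$ be a permutation of $\{1,\dots,d\}$ with $|\mathbf v_{i_1}|\le|\mathbf v_{i_2}|\le\dots\le|\mathbf v_{i_d}|$. Introduce a dummy index $i_0=0$ and dummy scalar $\mathbf v_{i_0}=0$, and for $k=0,\dots,d$ let $$s_k=\sum_{t=0}^{k-1}|\mathbf v_{i_t}|+\frac{(d-k+1)\hat\rho+1}{\hat\rho}|\mathbf v_{i_k}|,$$ with the convention $\sum_{t=0}^{-1}|\mathbf v_{i_t}|=0$. Then $(s_k)_{k=0}^d$ is non-decreasing and $\|\mathbf v\|_1<s_d$. If $\bar k$ satisfies $s_{\bar k}\le\|\mathbf v\|_1<s_{\bar k+1}$, then $$\mathbf z^*_{i_t}=\begin{cases}0,&1\le t\le\bar k,\\[2pt]\mathbf v_{i_t}-\dfrac{\mathrm{sgn}(\mathbf v_{i_t})\,\hat\rho}{\hat\rho(d-\bar k)+1}\displaystyle\sum_{j=\bar k+1}^d|\mathbf v_{i_j}|,&t>\bar k.\end{cases}$$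
   Context: $\mathbf v_i$ denotes the $i$-th component of $\mathbf v$; $\mathrm{sgn}(\alpha)=1,-1,0$ for $\alpha>0$, $\alpha<0$, $\alpha=0$ respectively. *)

theory Defs
  imports "HOL-Analysis.Analysis"
begin

definition l1_norm :: "real ^ 'n \<Rightarrow> real" where
  "l1_norm x = (\<Sum>i\<in>UNIV. \<bar>x $ i\<bar>)"

text \<open>On \<^typ>\<open>real ^ 'n\<close> the library's \<^const>\<open>norm\<close> is the Euclidean norm.\<close>

definition prox_objective :: "real \<Rightarrow> real ^ 'n \<Rightarrow> real ^ 'n \<Rightarrow> real" where
  "prox_objective \<rho> v z = 1 / 2 * (norm (z - v))\<^sup>2 + \<rho> / 2 * (l1_norm z)\<^sup>2"

definition optimal_solution :: "real \<Rightarrow> real ^ 'n \<Rightarrow> real ^ 'n \<Rightarrow> bool" where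
  "optimal_solution \<rho> v z \<longleftrightarrow> is_arg_min (prox_objective \<rho> v) (\<lambda>_. True) z"

text \<open>
  A permutation \<open>i\<^sub>1, \<dots>, i\<^sub>d\<close> of the coordinates is a bijection \<open>i\<close> from \<open>{1..d}\<close> onto the index
  type, where \<open>d = CARD('n)\<close>. The value \<open>i 0\<close> is never used: position \<open>0\<close> carries the dummy
  scalar \<open>0\<close>.
\<close>

definition permuted_entry :: "real ^ 'n \<Rightarrow> (nat \<Rightarrow> 'n) \<Rightarrow> nat \<Rightarrow> real" where
  "permuted_entry v i t = (if t = 0 then 0 else v $ i t)"

definition s_seq :: "real \<Rightarrow> real ^ 'n \<Rightarrow> (nat \<Rightarrow> 'n) \<Rightarrow> nat \<Rightarrow> real" where
  "s_seq \<rho> v i k = (\<Sum>t<k. \<bar>permuted_entry v i t\<bar>)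
     + ((real CARD('n) - real k + 1) * \<rho> + 1) / \<rho> * \<bar>permuted_entry v i k\<bar>"

text \<open>The optimal solution exists and is unique.\<close>

lemma l1_norm_nonneg: "0 \<le> l1_norm x"
  by (simp add: l1_norm_def sum_nonneg)

lemma l1_norm_midpoint: "l1_norm ((1 / 2) *\<^sub>R (x + y)) \<le> (l1_norm x + l1_norm y) / 2"
proof -
  have "l1_norm ((1 / 2) *\<^sub>R (x + y)) \<le> (\<Sum>i\<in>UNIV. (\<bar>x $ i\<bar> + \<bar>y $ i\<bar>) / 2)"
    unfolding l1_norm_def by (rule sum_mono) (simp add: abs_triangle_ineq)
  also have "\<dots> = (l1_norm x + l1_norm y) / 2"
    by (simp add: l1_norm_def sum.distrib flip: sum_divide_distrib)
  finally show ?thesis .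
qed

lemma optimal_solution_exists:
  fixes v :: "real ^ 'n"
  assumes "0 < \<rho>"
  shows "\<exists>z. optimal_solution \<rho> v z"
proof -
  have cont: "continuous_on (cball v (norm v)) (prox_objective \<rho> v)"
    unfolding prox_objective_def l1_norm_def by (intro continuous_intros)
  obtain z where z: "\<And>y. y \<in> cball v (norm v) \<Longrightarrow> prox_objective \<rho> v z \<le> prox_objective \<rho> v y"
    using continuous_attains_inf[OF compact_cball _ cont] by fastforce
  have "prox_objective \<rho> v z \<le> prox_objective \<rho> v y" for y
  proof (cases "y \<in> cball v (norm v)")
    case True
    then show ?thesis by (rule z)
  next
    case False
    then have "norm v \<le> norm (y - v)"
      by (simp add: dist_norm norm_minus_commute)
    then have "(norm v)\<^sup>2 \<le> (norm (y - v))\<^sup>2"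
      by (simp add: power_mono)
    moreover have "0 \<le> \<rho> / 2 * (l1_norm y)\<^sup>2"
      using assms by simp
    moreover have "prox_objective \<rho> v 0 = 1 / 2 * (norm v)\<^sup>2"
      by (simp add: prox_objective_def l1_norm_def)
    ultimately have "prox_objective \<rho> v 0 \<le> prox_objective \<rho> v y"
      unfolding prox_objective_def[of _ _ y] by linarith
    moreover have "prox_objective \<rho> v z \<le> prox_objective \<rho> v 0"
      by (rule z) (simp add: dist_norm)
    ultimately show ?thesis by simp
  qed
  then show ?thesis
    by (auto simp: optimal_solution_def is_arg_min_linorder)
qed

lemma parallelogram:
  fixes a b :: "'a::real_inner"
  shows "(norm (a + b))\<^sup>2 + (norm (a - b))\<^sup>2 = 2 * (norm a)\<^sup>2 + 2 * (norm b)\<^sup>2"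
  by (simp add: power2_norm_eq_inner inner_simps inner_commute)

lemma optimal_solution_unique:
  fixes v :: "real ^ 'n"
  assumes "0 < \<rho>" "optimal_solution \<rho> v x" "optimal_solution \<rho> v y"
  shows "x = y"
proof -
  define m where "m = (1 / 2) *\<^sub>R (x + y)"
  have le: "prox_objective \<rho> v x \<le> prox_objective \<rho> v m"
    "prox_objective \<rho> v y \<le> prox_objective \<rho> v m"
    using assms(2,3) by (auto simp: optimal_solution_def is_arg_min_linorder)
  have "(l1_norm m)\<^sup>2 \<le> ((l1_norm x + l1_norm y) / 2)\<^sup>2"
    unfolding m_def by (intro power_mono l1_norm_midpoint l1_norm_nonneg)
  also have "\<dots> \<le> ((l1_norm x)\<^sup>2 + (l1_norm y)\<^sup>2) / 2"
    using zero_le_power2[of "l1_norm x - l1_norm y"]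
    by (simp add: power2_eq_square field_simps)
  finally have l1: "\<rho> / 2 * (l1_norm m)\<^sup>2 \<le> \<rho> / 2 * (((l1_norm x)\<^sup>2 + (l1_norm y)\<^sup>2) / 2)"
    using assms(1) by (intro mult_left_mono) auto
  have "m - v = (1 / 2) *\<^sub>R ((x - v) + (y - v))"
    by (simp add: m_def vec_eq_iff field_simps)
  then have "(norm (m - v))\<^sup>2 = (norm ((x - v) + (y - v)))\<^sup>2 / 4"
    by (simp add: power2_eq_square)
  moreover have "(norm ((x - v) + (y - v)))\<^sup>2 + (norm (x - y))\<^sup>2
      = 2 * (norm (x - v))\<^sup>2 + 2 * (norm (y - v))\<^sup>2"
    using parallelogram[of "x - v" "y - v"] by simp
  ultimately have "(norm (x - y))\<^sup>2 \<le> 0"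
    using le l1 unfolding prox_objective_def add_divide_distrib distrib_left by linarith
  then show ?thesis by simp
qed

end

theory Submission
  imports Defs
begin

text \<open>
  Write \<open>L = \<parallel>z\<parallel>\<^sub>1\<close>. The optimality condition is that \<open>v - z\<close> lies in \<open>\<rho> L\<close> times the subdifferential
  of the \<open>\<ell>\<^sub>1\<close> norm at \<open>z\<close>, so \<open>z\<close> is \<open>v\<close> soft-thresholded at level \<open>\<tau> = \<rho> L\<close>. If exactly the
  positions after \<open>k\<close> survive, then summing \<open>\<bar>z\<^sub>j\<bar> = \<bar>v\<^sub>j\<bar> - \<tau>\<close> over them determines
  \<open>\<tau> = \<rho> (\<Sum>j>k. \<bar>v\<^sub>j\<bar>) / (\<rho> (d - k) + 1)\<close>, and the two inequalities
  \<open>s\<^sub>k \<le> \<parallel>v\<parallel>\<^sub>1 < s\<^sub>k\<^sub>+\<^sub>1\<close> say that \<open>\<bar>v\<^sub>k\<bar> \<le> \<tau> < \<bar>v\<^sub>k\<^sub>+\<^sub>1\<bar>\<close>.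
\<close>

lemma optimal_solutionI:
  fixes v w :: "real ^ 'n"
  assumes "0 < \<rho>"
    and dual: "\<And>j. \<bar>v $ j - w $ j\<bar> \<le> \<rho> * l1_norm w"
    and compl: "\<And>j. w $ j * (v $ j - w $ j) = \<rho> * l1_norm w * \<bar>w $ j\<bar>"
  shows "optimal_solution \<rho> v w"
proof -
  define L where "L = l1_norm w"
  have "prox_objective \<rho> v w \<le> prox_objective \<rho> v y" for y
  proof -
    \<comment> \<open>By \<open>dual\<close>, pairing with \<open>v - w\<close> yields at most
      \<open>\<rho> * L\<close> times the l1 norm; by \<open>compl\<close>, \<open>w\<close> itself
      attains this bound.\<close>
    have "y \<bullet> (v - w) \<le> (\<Sum>j\<in>UNIV. \<rho> * L * \<bar>y $ j\<bar>)"
      unfolding inner_vec_def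
    proof (rule sum_mono)
      fix j
      have "y $ j * (v $ j - w $ j) \<le> \<bar>y $ j\<bar> * \<bar>v $ j - w $ j\<bar>"
        by (metis abs_ge_self abs_mult)
      also have "\<dots> \<le> \<bar>y $ j\<bar> * (\<rho> * L)"
        using dual by (simp add: L_def mult_left_mono)
      finally show "y $ j \<bullet> (v - w) $ j \<le> \<rho> * L * \<bar>y $ j\<bar>"
        by (simp add: mult.commute)
    qed
    then have y: "y \<bullet> (v - w) \<le> \<rho> * L * l1_norm y"
      by (simp add: l1_norm_def sum_distrib_left)
    have w: "w \<bullet> (v - w) = \<rho> * L * L"
      by (simp add: inner_vec_def compl L_def flip: sum_distrib_left) (simp add: l1_norm_def)
    \<comment> \<open>With these two pairings, expanding around \<open>w\<close> bounds the
      objective gap below by half the square of \<open>norm (y - w)\<close> plus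
      \<open>\<rho> / 2\<close> times the square of \<open>l1_norm y - L\<close>.\<close>
    have "(norm (y - v))\<^sup>2 = (norm (y - w))\<^sup>2 + (norm (w - v))\<^sup>2 - 2 * (y \<bullet> (v - w)) + 2 * (w \<bullet> (v - w))"
      by (simp add: power2_norm_eq_inner inner_simps inner_commute)
    moreover have "0 \<le> \<rho> / 2 * (l1_norm y - L)\<^sup>2"
      using \<open>0 < \<rho>\<close> by simp
    then have "\<rho> * L * l1_norm y \<le> \<rho> / 2 * (l1_norm y)\<^sup>2 + \<rho> / 2 * L\<^sup>2"
      by (simp add: power2_eq_square algebra_simps)
    moreover have "\<rho> * L * L = \<rho> / 2 * L\<^sup>2 + \<rho> / 2 * L\<^sup>2"
      by (simp add: power2_eq_square)
    moreover have "0 \<le> (norm (y - w))\<^sup>2"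
      by simp
    ultimately show ?thesis
      using y w unfolding prox_objective_def L_def[symmetric] by linarith
  qed
  then show ?thesis
    by (auto simp: optimal_solution_def is_arg_min_linorder)
qed

text \<open>The equation for \<open>\<tau>\<close> is self-consistency: thresholding at
  \<open>\<tau>\<close> with survivors \<open>A\<close> gives a vector whose l1 norm times
  \<open>\<rho>\<close> is again \<open>\<tau>\<close>. That vector meets the optimality conditions,
  and uniqueness identifies it with \<open>z\<close>.\<close>

lemma optimal_solution_soft_threshold:
  fixes v z :: "real ^ 'n"
  assumes "0 < \<rho>" and "optimal_solution \<rho> v z" and "0 \<le> \<tau>"
    and \<tau>: "\<tau> = \<rho> * (\<Sum>j\<in>A. \<bar>v $ j\<bar> - \<tau>)"
    and out: "\<And>j. j \<notin> A \<Longrightarrow> \<bar>v $ j\<bar> \<le> \<tau>"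
    and "in": "\<And>j. j \<in> A \<Longrightarrow> \<tau> < \<bar>v $ j\<bar>"
  shows "z $ j = (if j \<in> A then v $ j - sgn (v $ j) * \<tau> else 0)"
proof -
  define w :: "real ^ 'n" where
    "w = (\<chi> j. if j \<in> A then v $ j - sgn (v $ j) * \<tau> else 0)"
  \<comment> \<open>On \<open>A\<close> the shift by \<open>\<tau>\<close> is smaller than the
    entry, so signs survive.\<close>
  have abs_w: "\<bar>w $ j\<bar> = (if j \<in> A then \<bar>v $ j\<bar> - \<tau> else 0)" for j
    using "in"[of j] \<open>0 \<le> \<tau>\<close> by (auto simp: w_def sgn_if abs_if)
  have "l1_norm w = (\<Sum>j\<in>A. \<bar>v $ j\<bar> - \<tau>)"
    by (simp add: l1_norm_def abs_w sum.If_cases)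
  with \<tau> have level: "\<rho> * l1_norm w = \<tau>"
    by simp
  have "optimal_solution \<rho> v w"
  proof (rule optimal_solutionI[OF \<open>0 < \<rho>\<close>]; unfold level)
    fix j
    show "\<bar>v $ j - w $ j\<bar> \<le> \<tau>"
      using out[of j] \<open>0 \<le> \<tau>\<close> by (auto simp: w_def sgn_if)
    show "w $ j * (v $ j - w $ j) = \<tau> * \<bar>w $ j\<bar>"
      unfolding abs_w using "in"[of j] \<open>0 \<le> \<tau>\<close> by (auto simp: w_def sgn_if algebra_simps)
  qed
  then have "z = w"
    using assms(1,2) optimal_solution_unique by blast
  then show ?thesis
    by (simp add: w_def)
qed

lemma optimal_solution_zero:
  assumes "0 < \<rho>" and "optimal_solution \<rho> 0 z"
  shows "z = 0"
  using optimal_solution_soft_threshold[OF assms, of 0 "{}"] by (simp add: vec_eq_iff)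

lemma mono_on_permuted_entry:
  assumes "mono_on {1..n} (\<lambda>t. \<bar>v $ i t\<bar>)"
  shows "mono_on {0..n} (\<lambda>t. \<bar>permuted_entry v i t\<bar>)"
  using assms by (auto simp: mono_on_def permuted_entry_def)

lemma l1_norm_permuted_entry:
  fixes v :: "real ^ 'n"
  assumes "bij_betw i {1..CARD('n)} UNIV"
  shows "l1_norm v = (\<Sum>t\<le>CARD('n). \<bar>permuted_entry v i t\<bar>)"
proof -
  have "l1_norm v = (\<Sum>t\<in>{1..CARD('n)}. \<bar>v $ i t\<bar>)"
    unfolding l1_norm_def by (rule sum.reindex_bij_betw[OF assms, symmetric])
  also have "\<dots> = (\<Sum>t\<in>{1..CARD('n)}. \<bar>permuted_entry v i t\<bar>)"
    by (rule sum.cong) (auto simp: permuted_entry_def)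
  also have "\<dots> = (\<Sum>t\<le>CARD('n). \<bar>permuted_entry v i t\<bar>)"
    by (rule sum.mono_neutral_left) (auto simp: permuted_entry_def)
  finally show ?thesis .
qed

text \<open>One copy of the last entry moves into the sum, lowering its coefficient by 1.\<close>

lemma s_seq_eq:
  fixes v :: "real ^ 'n"
  assumes "0 < \<rho>"
  shows "s_seq \<rho> v i k = (\<Sum>t\<le>k. \<bar>permuted_entry v i t\<bar>)
    + (real CARD('n) - real k + 1 / \<rho>) * \<bar>permuted_entry v i k\<bar>"
  using assms by (simp add: s_seq_def field_simps flip: lessThan_Suc_atMost)

text \<open>Prefix sum and coefficient agree with those of \<open>s_seq_eq\<close> at
  \<open>k\<close>, so consecutive terms differ only in the entry that is multiplied.\<close>

lemma s_seq_Suc: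
  fixes v :: "real ^ 'n"
  assumes "0 < \<rho>"
  shows "s_seq \<rho> v i (Suc k) = (\<Sum>t\<le>k. \<bar>permuted_entry v i t\<bar>)
    + (real CARD('n) - real k + 1 / \<rho>) * \<bar>permuted_entry v i (Suc k)\<bar>"
  using assms by (simp add: s_seq_eq field_simps)

lemma mono_on_s_seq:
  fixes v :: "real ^ 'n"
  assumes "0 < \<rho>" and "mono_on {1..CARD('n)} (\<lambda>t. \<bar>v $ i t\<bar>)"
  shows "mono_on {0..CARD('n)} (s_seq \<rho> v i)"
proof (rule mono_onI)
  have s_step: "s_seq \<rho> v i k \<le> s_seq \<rho> v i (Suc k)" if "k < CARD('n)" for k
  proof -
    have "\<bar>permuted_entry v i k\<bar> \<le> \<bar>permuted_entry v i (Suc k)\<bar>"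
      using that by (intro mono_onD[OF mono_on_permuted_entry[OF assms(2)]]) auto
    then show ?thesis
      using that \<open>0 < \<rho>\<close>
      unfolding s_seq_eq[OF \<open>0 < \<rho>\<close>, of _ _ k] s_seq_Suc[OF \<open>0 < \<rho>\<close>]
      by (intro add_left_mono mult_left_mono) auto
  qed
  fix a b assume "a \<in> {0..CARD('n)}" "b \<in> {0..CARD('n)}" "a \<le> b"
  from \<open>a \<le> b\<close> \<open>b \<in> {0..CARD('n)}\<close> show "s_seq \<rho> v i a \<le> s_seq \<rho> v i b"
  proof (induction b rule: dec_induct)
    case (step n)
    then show ?case
      using s_step[of n] by simp
  qed simp
qed

text \<open>At the last index the prefix sum is the whole norm and the coefficient is
  \<open>1 / \<rho>\<close>; the largest absolute entry of a nonzero vector is positive.\<close>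

lemma l1_norm_less_s_seq:
  fixes v :: "real ^ 'n"
  assumes "0 < \<rho>" and "v \<noteq> 0" and bij: "bij_betw i {1..CARD('n)} UNIV"
    and mono: "mono_on {1..CARD('n)} (\<lambda>t. \<bar>v $ i t\<bar>)"
  shows "l1_norm v < s_seq \<rho> v i CARD('n)"
proof -
  obtain j where "v $ j \<noteq> 0"
    using \<open>v \<noteq> 0\<close> by (auto simp: vec_eq_iff)
  moreover obtain t where "t \<in> {1..CARD('n)}" "i t = j"
    using bij by (metis UNIV_I bij_betw_imp_surj_on imageE)
  moreover from this have "\<bar>v $ i t\<bar> \<le> \<bar>v $ i CARD('n)\<bar>"
    by (intro mono_onD[OF mono]) auto
  ultimately have "0 < \<bar>permuted_entry v i CARD('n)\<bar>"
    by (auto simp: permuted_entry_def)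
  then show ?thesis
    using \<open>0 < \<rho>\<close> by (simp add: s_seq_eq l1_norm_permuted_entry[OF bij])
qed

lemma optimal_solution_entry:
  fixes v z :: "real ^ 'n"
  assumes "0 < \<rho>" and "optimal_solution \<rho> v z"
    and bij: "bij_betw i {1..CARD('n)} UNIV"
    and mono: "mono_on {1..CARD('n)} (\<lambda>t. \<bar>v $ i t\<bar>)"
    and "k < CARD('n)"
    and lower: "s_seq \<rho> v i k \<le> l1_norm v" and upper: "l1_norm v < s_seq \<rho> v i (k + 1)"
    and "t \<in> {1..CARD('n)}"
  shows "z $ i t = (if t \<le> k then 0
    else v $ i t - sgn (v $ i t) * \<rho> / (\<rho> * (real CARD('n) - real k) + 1)
      * (\<Sum>j=k+1..CARD('n). \<bar>v $ i j\<bar>))"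
proof -
  let ?p = "\<lambda>t. \<bar>permuted_entry v i t\<bar>"
  define S where "S = (\<Sum>j=k+1..CARD('n). \<bar>v $ i j\<bar>)"
  \<comment> \<open>\<open>c\<close> is the coefficient shared by terms \<open>k\<close> and
    \<open>k + 1\<close>; \<open>\<rho> * c\<close> is the denominator in the claim.\<close>
  define c where "c = real CARD('n) - real k + 1 / \<rho>"
  define \<tau> where "\<tau> = \<rho> / (\<rho> * (real CARD('n) - real k) + 1) * S"
  define A where "A = i ` {k+1..CARD('n)}"
  have "0 < c"
    using \<open>0 < \<rho>\<close> \<open>k < CARD('n)\<close> unfolding c_def by (intro add_pos_pos) auto
  have "\<rho> * (real CARD('n) - real k) + 1 = \<rho> * c"
    using \<open>0 < \<rho>\<close> by (simp add: c_def field_simps)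
  then have \<tau>: "\<tau> = S / c"
    using \<open>0 < \<rho>\<close> by (simp add: \<tau>_def)
  have "S = (\<Sum>t=k+1..CARD('n). ?p t)"
    unfolding S_def by (rule sum.cong) (auto simp: permuted_entry_def)
  moreover have "{..CARD('n)} = {..k} \<union> {k+1..CARD('n)}"
    using \<open>k < CARD('n)\<close> by auto
  ultimately have l1: "l1_norm v = (\<Sum>t\<le>k. ?p t) + S"
    unfolding l1_norm_permuted_entry[OF bij] by (simp add: sum.union_disjoint)
  \<comment> \<open>After cancelling the common prefix sum, \<open>lower\<close> reads
    \<open>c * ?p k \<le> S\<close>, and \<open>upper\<close> likewise reads
    \<open>S < c * ?p (k + 1)\<close>. For \<open>k = 0\<close> the dummy entry 0 stands on the
    left.\<close>
  have "?p k \<le> \<tau>"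
    using lower \<open>0 < c\<close>
    by (simp add: s_seq_eq[OF \<open>0 < \<rho>\<close>] l1 \<tau> flip: c_def) (simp add: field_simps)
  have "\<tau> < ?p (k + 1)"
    using upper \<open>0 < c\<close>
    by (simp add: s_seq_Suc[OF \<open>0 < \<rho>\<close>] l1 \<tau> flip: c_def) (simp add: field_simps)
  have le: "\<bar>v $ i t\<bar> \<le> \<tau>" if "t \<in> {1..k}" for t
  proof -
    have "?p t \<le> ?p k"
      using that \<open>k < CARD('n)\<close> by (intro mono_onD[OF mono_on_permuted_entry[OF mono]]) auto
    with \<open>?p k \<le> \<tau>\<close> that show ?thesis
      by (auto simp: permuted_entry_def)
  qed
  have gt: "\<tau> < \<bar>v $ i t\<bar>" if "t \<in> {k+1..CARD('n)}" for t
  proof -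
    have "?p (k + 1) \<le> ?p t"
      using that \<open>k < CARD('n)\<close> by (intro mono_onD[OF mono_on_permuted_entry[OF mono]]) auto
    with \<open>\<tau> < ?p (k + 1)\<close> that show ?thesis
      by (auto simp: permuted_entry_def)
  qed
  have inj: "inj_on i {1..CARD('n)}"
    using bij by (rule bij_betw_imp_inj_on)
  \<comment> \<open>Injectivity turns the split of coordinates by \<open>A\<close> into the split of
    positions at \<open>k\<close>.\<close>
  have mem_A: "i t \<in> A \<longleftrightarrow> k < t" if "t \<in> {1..CARD('n)}" for t
    using that inj_on_image_mem_iff[OF inj, of t "{k+1..CARD('n)}"] by (auto simp: A_def)
  have outside: "\<bar>v $ j\<bar> \<le> \<tau>" if "j \<notin> A" for j
  proof -
    obtain t where "t \<in> {1..CARD('n)}" "j = i t"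
      using bij by (metis UNIV_I bij_betw_imp_surj_on imageE)
    with that mem_A le show ?thesis
      by auto
  qed
  have "(\<Sum>j\<in>A. \<bar>v $ j\<bar> - \<tau>) = (\<Sum>t=k+1..CARD('n). \<bar>v $ i t\<bar> - \<tau>)"
    unfolding A_def by (subst sum.reindex) (auto intro: inj_on_subset[OF inj])
  \<comment> \<open>The number of survivors is \<open>c - 1 / \<rho>\<close>; since
    \<open>S = c * \<tau>\<close>, only \<open>\<tau> / \<rho>\<close> remains.\<close>
  also have "\<dots> = S - (c - 1 / \<rho>) * \<tau>"
    using \<open>k < CARD('n)\<close> by (simp add: sum_subtractf S_def c_def of_nat_diff)
  also have "\<dots> = \<tau> / \<rho>"
    using \<open>0 < c\<close> \<open>0 < \<rho>\<close> by (simp add: \<tau> field_simps)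
  finally have "\<tau> = \<rho> * (\<Sum>j\<in>A. \<bar>v $ j\<bar> - \<tau>)"
    using \<open>0 < \<rho>\<close> by simp
  moreover have "0 \<le> \<tau>"
    using \<open>0 < c\<close> by (simp add: \<tau> S_def sum_nonneg)
  ultimately have "z $ i t = (if i t \<in> A then v $ i t - sgn (v $ i t) * \<tau> else 0)"
    using outside gt
    by (intro optimal_solution_soft_threshold[OF assms(1,2)]) (auto simp: A_def)
  then show ?thesis
    using mem_A[OF \<open>t \<in> {1..CARD('n)}\<close>] by (simp add: \<tau>_def S_def)
qed

theorem lemma9:
  fixes v z :: "real ^ 'n" and \<rho> :: real
  assumes "0 < \<rho>"
    and "optimal_solution \<rho> v z"
  shows "(v = 0 \<longrightarrow> z = 0) \<and>
    (v \<noteq> 0 \<longrightarrow>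
      (\<forall>i :: nat \<Rightarrow> 'n.
        bij_betw i {1..CARD('n)} UNIV \<and>
        mono_on {1..CARD('n)} (\<lambda>t. \<bar>v $ i t\<bar>) \<longrightarrow>
          mono_on {0..CARD('n)} (s_seq \<rho> v i) \<and>
          l1_norm v < s_seq \<rho> v i CARD('n) \<and>
          (\<forall>k<CARD('n).
            s_seq \<rho> v i k \<le> l1_norm v \<and> l1_norm v < s_seq \<rho> v i (k + 1) \<longrightarrow>
              (\<forall>t\<in>{1..CARD('n)}.
                z $ i t =
                  (if t \<le> k then 0
                   else v $ i t
                     - sgn (v $ i t) * \<rho> / (\<rho> * (real CARD('n) - real k) + 1)
                       * (\<Sum>j=k+1..CARD('n). \<bar>v $ i j\<bar>))))))"
  using optimal_solution_zero[OF assms(1)] assms(2) mono_on_s_seq[OF assms(1)]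
    l1_norm_less_s_seq[OF assms(1)] optimal_solution_entry[OF assms]
  by blast

end
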